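(* Let $n$ be an integer with $n \geq 7$ and $n \equiv 3 \pmod 4$. Then there is no $\left[2^{\frac{n+1}{2}}-3,\ 2^{\frac{n+1}{2}}-n-3,\ 5\right]$-code. Equivalently, for any even integer $t \geq 4$, there is no $[2^t-3,\ 2^t-2t-2,\ 5]$-code.
   Context: An $[N,k,d]$-code is a (binary) linear code $C$ of length $N$, dimension $k$ and minimum distance $d$, i.e. a $k$-dimensional linear subspace $C$ of $\mathbb{F}_2^N$ with $d = \min_{c \in C\setminus\{0\}} \operatorname{wt}(c)$, where the Hamming weight $\operatorname{wt}(c)$ is the number of nonzero entries of the vector $c$. *)

theory Defs
  imports "HOL-Analysis.Analysis" "HOL-Library.Z2"
begin

definition hamming_weight :: "bit ^ 'm \<Rightarrow> nat" where
  "hamming_weight c = card {i. c $ i \<noteq> 0}"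

definition min_distance :: "(bit ^ 'm) set \<Rightarrow> nat" where
  "min_distance C = Min (hamming_weight ` (C - {0}))"

(* The ambient space F_2^N is bit ^ 'm with CARD('m) = N, for an arbitrary finite
   index type 'm.  The zero code has no minimum distance, so it is not an [N,k,d]-code
   for any d; for k > 0 the condition C \<noteq> {0} is automatic. *)
definition is_code :: "nat \<Rightarrow> nat \<Rightarrow> nat \<Rightarrow> (bit ^ 'm::finite) set \<Rightarrow> bool" where
  "is_code N k d C \<longleftrightarrow>
     CARD('m) = N \<and> vec.subspace C \<and> vec.dim C = k \<and> C \<noteq> {0} \<and> min_distance C = d"

end

theory Submission
  imports Defs
begin

text \<open>
Let \<open>q = 2 ^ t = 4 * m\<^sup>2\<close> with \<open>m\<close> even, and suppose that \<open>C\<close> is a code with the forbidden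
parameters. Its dual \<open>D\<close> has \<open>2 ^ (2 * t - 1) = q\<^sup>2 / 2\<close> elements. The zero vector and the unit
vectors form a family \<open>e\<close> of \<open>q - 2\<close> vectors, and minimum distance 5 says that it is a Sidon set
modulo \<open>C\<close>: \<open>e i + e j + e k + e l \<in> C\<close> only if the four indices pair off
(\<open>sidon_family_unit_or_zero\<close>). It remains to show that a dual of this size admits no such
family (\<open>card_dual_ne\<close>).

Let \<open>f u\<close> be the sum of the signs \<open>(- 1) ^ (u \<bullet> e i)\<close> over the family, and let \<open>\<sigma>\<close> be the sum of
the family. If \<open>u \<in> D\<close> is orthogonal to \<open>\<sigma>\<close>, then an even number of signs is negative, so \<open>f u\<close> is
congruent to \<open>q - 2\<close>, that is to 2, modulo 4 (\<open>char_sum_mod_4\<close>). The natural size of \<open>f u\<close> is the square root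
\<open>2 * m\<close> of \<open>q\<close>, but this is divisible by 4; hence \<open>f u\<close> avoids the open intervals between
\<open>2 * m - 2\<close> and \<open>2 * m + 2\<close> and between their negatives, and
\<open>(f u\<^sup>2 - (2 * m - 2)\<^sup>2) * (f u\<^sup>2 - (2 * m + 2)\<^sup>2) \<ge> 0\<close>.

Sum this over all \<open>u \<in> D\<close> orthogonal to \<open>\<sigma>\<close>. Orthogonality of characters turns the second and
fourth moments into the numbers of ways to write \<open>0\<close> and \<open>\<sigma>\<close> as sums of two or of four members
of the family modulo \<open>C\<close>. The Sidon property leaves only trivial ways for \<open>0\<close>, and also for \<open>\<sigma>\<close> if
\<open>\<sigma> \<in> C\<close>. Otherwise the representations of \<open>\<sigma>\<close> as a sum of four have to be bounded. Fixing the first summand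
\<open>e c\<close>, the triples that sum to \<open>\<sigma> + e c\<close> are pairwise disjoint, and unless \<open>\<sigma> + e c\<close> is congruent to a
member of the family they account for all representations of it; since \<open>q\<close> is 1 modulo 3, they leave
at least two of the \<open>q - 2\<close> indices uncovered. If they leave exactly two, then their number
\<open>(q - 4) div 3\<close> is even because \<open>q\<close> is, the covered members sum to zero modulo \<open>C\<close>, and \<open>\<sigma>\<close> is congruent to the
sum of the two uncovered members. So either there is a pair summing to \<open>\<sigma>\<close>, which contributes to
the second moment, or the triples are fewer (\<open>rep4_le_collision\<close>,
\<open>rep4_le_no_collision\<close>). In every case the sum is smaller than the contribution of \<open>u = 0\<close>
alone, where \<open>f u = q - 2\<close>; this is a contradiction.
\<close>

section \<open>Binary vector spaces\<close>

instance bit :: finite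
proof
  have "(UNIV :: bit set) = {0, 1}"
    using bit_not_zero_iff by blast
  then show "finite (UNIV :: bit set)"
    by (metis finite.emptyI finite_insert)
qed

lemma card_UNIV_bit: "CARD(bit) = 2"
proof -
  have "(UNIV :: bit set) = {0, 1}"
    using bit_not_zero_iff by blast
  then show ?thesis
    by (metis card_2_iff zero_neq_one)
qed

lemma add_self_bit_vec [simp]: "(x :: bit ^ 'm) + x = 0"
  by (simp add: vec_eq_iff)

lemma minus_bit_vec: "(x :: bit ^ 'm) - y = x + y"
  by (simp add: vec_eq_iff)

lemma add_self_left_bit_vec [simp]: "(x :: bit ^ 'm) + (x + y) = y"
  by (metis add_self_bit_vec add.assoc add_0)

lemma subspace_bit_iff:
  "vec.subspace (C :: (bit ^ 'm) set) \<longleftrightarrow> 0 \<in> C \<and> (\<forall>x\<in>C. \<forall>y\<in>C. x + y \<in> C)"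
proof -
  have "c *s x \<in> C" if "0 \<in> C" "x \<in> C" for c x
    using that by (cases c) simp_all
  then show ?thesis
    unfolding vec.subspace_def by blast
qed

lemma card_span_bit:
  fixes B :: "(bit ^ 'm::finite) set"
  assumes "vec.independent B"
  shows "card (vec.span B) = 2 ^ card B"
proof -
  have "finite B"
    by simp
  then show ?thesis
    using assms
  proof (induction B rule: finite_induct)
    case empty
    then show ?case by simp
  next
    case (insert b B)
    have indep: "vec.independent B" and b: "b \<notin> vec.span B"
      using insert.prems insert.hyps by (auto simp: vec.independent_insert)
    let ?W = "vec.span B"
    have W: "x + y \<in> ?W" if "x \<in> ?W" "y \<in> ?W" for x y
      using that by (rule vec.span_add)
    have split: "vec.span (insert b B) = ?W \<union> (+) b ` ?W"
    proof (intro set_eqI)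
      fix x
      have "(\<exists>k. x - k *s b \<in> ?W) \<longleftrightarrow> x \<in> ?W \<or> x + b \<in> ?W"
        by (metis (full_types) bit_not_zero_iff minus_bit_vec add_0_right vec.scale_zero_left vec.scale_one)
      also have "x + b \<in> ?W \<longleftrightarrow> x \<in> (+) b ` ?W"
        by (metis (no_types, lifting) add.commute add_self_left_bit_vec image_iff)
      finally show "x \<in> vec.span (insert b B) \<longleftrightarrow> x \<in> ?W \<union> (+) b ` ?W"
        by (simp add: vec.span_breakdown_eq)
    qed
    have "?W \<inter> (+) b ` ?W = {}"
    proof (rule equals0I)
      fix x assume "x \<in> ?W \<inter> (+) b ` ?W"
      then obtain y where "y \<in> ?W" "b + y \<in> ?W" by blast
      then have "b + y + y \<in> ?W" using W by blast
      then show False using b by (simp add: add.assoc)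
    qed
    then have "card (vec.span (insert b B)) = card ?W + card ((+) b ` ?W)"
      unfolding split by (intro card_Un_disjoint) simp_all
    also have "card ((+) b ` ?W) = card ?W"
      by (intro card_image) (simp add: inj_on_def)
    finally show ?case
      using insert.IH[OF indep] insert.hyps by simp
  qed
qed

lemma card_subspace_bit:
  fixes C :: "(bit ^ 'm::finite) set"
  assumes "vec.subspace C"
  shows "card C = 2 ^ vec.dim C"
  by (metis assms card_span_bit vec.basis_exists vec.span_subspace)

section \<open>Characters and the dual code\<close>

definition character :: "bit ^ 'm::finite \<Rightarrow> bit ^ 'm \<Rightarrow> int" where
  "character u v = (if (\<Sum>i\<in>UNIV. u $ i * v $ i) = 0 then 1 else - 1)"

lemma character_commute: "character u v = character v u"
  unfolding character_def by (simp only: mult.commute)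

lemma character_add_right: "character u (v + w) = character u v * character u w"
proof -
  have sgn: "(if a + b = 0 then 1 else - 1 :: int) = (if a = 0 then 1 else - 1) * (if b = 0 then 1 else - 1)"
    for a b :: bit
    by (cases a; cases b) simp_all
  have "(\<Sum>i\<in>UNIV. u $ i * (v + w) $ i) = (\<Sum>i\<in>UNIV. u $ i * v $ i) + (\<Sum>i\<in>UNIV. u $ i * w $ i)"
    by (simp only: vector_add_component distrib_left sum.distrib)
  then show ?thesis
    unfolding character_def by (simp only: sgn)
qed

lemma character_add_left: "character (u + v) w = character u w * character v w"
  by (metis character_commute character_add_right)

lemma character_cases: "character u v = 1 \<or> character u v = - 1"
  by (simp add: character_def)

lemma character_zero_left [simp]: "character 0 v = 1"
  unfolding character_def by simp

lemma character_zero_right [simp]: "character u 0 = 1"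
  unfolding character_def by simp

lemma character_sum_right: "character u (\<Sum>i\<in>A. v i) = (\<Prod>i\<in>A. character u (v i))"
  by (induction A rule: infinite_finite_induct) (simp_all add: character_add_right)

definition dual :: "(bit ^ 'm::finite) set \<Rightarrow> (bit ^ 'm) set" where
  "dual C = {u. \<forall>c\<in>C. character u c = 1}"

lemma subspace_dual: "vec.subspace (dual C)"
  unfolding subspace_bit_iff dual_def by (simp add: character_add_left)

text \<open>The dot product is nondegenerate: a vector with a nonzero coordinate is detected by the
corresponding unit vector.\<close>

lemma dual_UNIV: "dual UNIV = {0 :: bit ^ 'm::finite}"
proof (intro set_eqI)
  fix u :: "bit ^ 'm"
  have "u = 0" if "\<forall>v. character u v = 1"
  proof (rule ccontr)
    assume "u \<noteq> 0"
    then obtain i where i: "u $ i = 1"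
      by (metis bit_not_zero_iff vec_eq_iff zero_index)
    have "(\<Sum>j\<in>UNIV. u $ j * axis i 1 $ j) = (\<Sum>j\<in>UNIV. if j = i then u $ i else 0)"
      by (intro sum.cong) (simp_all add: axis_def del: mult_bit_eq_and)
    also have "\<dots> = 1"
      using i by simp
    finally show False
      using that[rule_format, of "axis i 1"] by (simp add: character_def)
  qed
  then show "u \<in> dual UNIV \<longleftrightarrow> u \<in> {0}"
    by (auto simp: dual_def)
qed

text \<open>If some \<open>d\<close> in the subspace has \<open>character d v = - 1\<close>, then translation by \<open>d\<close> permutes
the summands and flips every sign, so the sum vanishes.\<close>

lemma sum_character_subspace:
  assumes "vec.subspace C"
  shows "(\<Sum>c\<in>C. character c v) = (if v \<in> dual C then int (card C) else 0)"
proof (cases "v \<in> dual C")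
  case True
  then have "(\<Sum>c\<in>C. character c v) = (\<Sum>c\<in>C. 1)"
    by (intro sum.cong) (simp_all add: dual_def character_commute)
  then show ?thesis
    using True by simp
next
  case False
  then obtain d where "d \<in> C" "character d v \<noteq> 1"
    by (auto simp: dual_def character_commute[of v])
  then have d: "d \<in> C" "character d v = - 1"
    using character_cases[of d v] by auto
  have "(\<Sum>c\<in>C. character c v) = (\<Sum>c\<in>C. character (d + c) v)"
    by (rule sum.reindex_bij_witness[of _ "(+) d" "(+) d"])
      (use assms d(1) in \<open>auto simp: subspace_bit_iff\<close>)
  also have "\<dots> = - (\<Sum>c\<in>C. character c v)"
    by (simp add: character_add_left d(2) sum_negf)
  finally show ?thesis
    using False by simp
qed

text \<open>Double counting of the character sum over all pairs of a vector and a code word. Together with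
the trivial inclusion of a code in its bidual, this count replaces the rank argument in the proof
of \<open>dual_dual\<close>.\<close>

lemma card_mult_card_dual:
  fixes C :: "(bit ^ 'm::finite) set"
  assumes "vec.subspace C"
  shows "card C * card (dual C) = 2 ^ CARD('m)"
proof -
  have "int (card C * card (dual C)) = (\<Sum>v\<in>UNIV. \<Sum>c\<in>C. character c v)"
    by (simp add: sum_character_subspace[OF assms] sum.If_cases)
  also have "\<dots> = (\<Sum>c\<in>C. \<Sum>v\<in>UNIV. character v c)"
    by (subst sum.swap) (simp only: character_commute)
  also have "\<dots> = (\<Sum>c\<in>C. if c = 0 then 2 ^ CARD('m) else 0)"
    using sum_character_subspace[of "UNIV :: (bit ^ 'm) set"] by (simp add: dual_UNIV card_UNIV_bit)
  also have "\<dots> = 2 ^ CARD('m)"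
    using assms by (simp add: subspace_bit_iff)
  finally show ?thesis
    by (metis of_nat_eq_iff of_nat_numeral of_nat_power)
qed

lemma dual_dual:
  assumes "vec.subspace C"
  shows "dual (dual C) = C"
proof -
  have "C \<subseteq> dual (dual C)"
    by (auto simp: dual_def character_commute)
  moreover have "card C = card (dual (dual C))"
    using card_mult_card_dual[OF assms] card_mult_card_dual[OF subspace_dual, of C]
    by (metis mult.commute mult_cancel2 power_not_zero zero_neq_numeral mult_zero_right)
  ultimately show ?thesis
    by (metis card_subset_eq finite)
qed

corollary sum_character_dual:
  assumes "vec.subspace C"
  shows "(\<Sum>u\<in>dual C. character u v) = (if v \<in> C then int (card (dual C)) else 0)"
  using sum_character_subspace[OF subspace_dual[of C]] by (simp add: dual_dual[OF assms])

text \<open>The sum runs over the part of the dual on which the character of \<open>w\<close> is trivial. The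
factor \<open>(1 + character u w) / 2\<close> is the indicator of that part, which is why solutions of
\<open>s a \<in> C\<close> and of \<open>w + s a \<in> C\<close> are counted together. If \<open>w\<close> lies in the code, that part is
the whole dual and the two counts agree.\<close>

lemma sum_character_half_dual:
  fixes s :: "'a::finite \<Rightarrow> bit ^ 'm::finite"
  assumes "vec.subspace C"
  shows "2 * (\<Sum>u | u \<in> dual C \<and> character u w = 1. \<Sum>a\<in>UNIV. character u (s a))
    = int (card (dual C)) * (int (card {a. s a \<in> C}) + int (card {a. w + s a \<in> C}))"
proof -
  have full: "(\<Sum>u\<in>dual C. \<Sum>a\<in>UNIV. character u (r a)) = int (card (dual C)) * int (card {a. r a \<in> C})"
    for r :: "'a \<Rightarrow> bit ^ 'm"
    by (subst sum.swap) (simp add: sum_character_dual[OF assms] sum.If_cases)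
  have "2 * (\<Sum>u | u \<in> dual C \<and> character u w = 1. \<Sum>a\<in>UNIV. character u (s a))
    = (\<Sum>u\<in>dual C. if character u w = 1 then 2 * (\<Sum>a\<in>UNIV. character u (s a)) else 0)"
    by (auto simp: sum_distrib_left sum.inter_filter intro: sum.cong)
  also have "\<dots> = (\<Sum>u\<in>dual C. (\<Sum>a\<in>UNIV. character u (s a)) + (\<Sum>a\<in>UNIV. character u (w + s a)))"
  proof (intro sum.cong refl)
    fix u
    show "(if character u w = 1 then 2 * (\<Sum>a\<in>UNIV. character u (s a)) else 0)
      = (\<Sum>a\<in>UNIV. character u (s a)) + (\<Sum>a\<in>UNIV. character u (w + s a))"
      using character_cases[of u w]
      by (auto simp: character_add_right sum_negf)
  qed
  finally show ?thesis
    by (simp add: sum.distrib full distrib_left)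
qed

text \<open>The expression is the product \<open>(f\<^sup>2 - (2 * m - 2)\<^sup>2) * (f\<^sup>2 - (2 * m + 2)\<^sup>2)\<close>. It is
negative only if \<open>\<bar>f div 2\<bar>\<close> lies strictly between \<open>m - 1\<close> and \<open>m + 1\<close>, that is, equals \<open>m\<close>; but
\<open>f div 2\<close> is odd and \<open>m\<close> is even.\<close>

lemma square_mod_four_bound:
  fixes m f :: int
  assumes "even m" "m \<ge> 0" "f mod 4 = 2"
  shows "0 \<le> f ^ 4 - 2 * (4 * m\<^sup>2 + 4) * f\<^sup>2 + (4 * m\<^sup>2 - 4)\<^sup>2"
proof -
  have "f = 2 * (f div 2)" "odd (f div 2)"
    using assms(3) by presburger+
  then obtain g where g: "f = 2 * g" "odd g"
    by blast
  have "0 \<le> (g\<^sup>2 - (m - 1)\<^sup>2) * (g\<^sup>2 - (m + 1)\<^sup>2)"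
  proof (cases "\<bar>g\<bar> \<le> m - 1")
    case True
    then have "g\<^sup>2 \<le> (m - 1)\<^sup>2" "g\<^sup>2 \<le> (m + 1)\<^sup>2"
      by (auto simp flip: abs_le_square_iff)
    then show ?thesis
      by (simp add: mult_nonpos_nonpos)
  next
    case False
    have "\<bar>g\<bar> \<noteq> m"
      using g assms by presburger
    then have "m + 1 \<le> \<bar>g\<bar>"
      using False by linarith
    then have "(m - 1)\<^sup>2 \<le> g\<^sup>2" "(m + 1)\<^sup>2 \<le> g\<^sup>2"
      using assms(2) by (auto simp flip: abs_le_square_iff)
    then show ?thesis
      by simp
  qed
  also have "16 * ((g\<^sup>2 - (m - 1)\<^sup>2) * (g\<^sup>2 - (m + 1)\<^sup>2))
    = f ^ 4 - 2 * (4 * m\<^sup>2 + 4) * f\<^sup>2 + (4 * m\<^sup>2 - 4)\<^sup>2"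
    unfolding g by (simp add: power2_eq_square power4_eq_xxxx algebra_simps)
  finally show ?thesis 
    by simp
qed

section \<open>Families that are Sidon modulo a code\<close>

text \<open>The images of the \<open>e i\<close> in the quotient space by \<open>C\<close> form a Sidon set. Representatives are
used so that the quotient, whose dimension would have to be a type, never has to be formed.\<close>

locale sidon_family =
  fixes C :: "(bit ^ 'm::finite) set" and e :: "'i::finite \<Rightarrow> bit ^ 'm"
  assumes subspace: "vec.subspace C"
    and sidon: "e i + e j + e k + e l \<in> C \<Longrightarrow> i = j \<and> k = l \<or> i = k \<and> j = l \<or> i = l \<and> j = k"
begin

lemma zero_mem: "0 \<in> C"
  using subspace by (simp add: subspace_bit_iff)

lemma add_mem: "x \<in> C \<Longrightarrow> y \<in> C \<Longrightarrow> x + y \<in> C"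
  using subspace by (simp add: subspace_bit_iff)

text \<open>The representation numbers count ordered tuples, including those with repeated entries, since
these are the counts that moments of character sums produce.\<close>

definition rep2 :: "bit ^ 'm \<Rightarrow> nat" where
  "rep2 x = card {(i, j). x + (e i + e j) \<in> C}"

definition rep3 :: "bit ^ 'm \<Rightarrow> nat" where
  "rep3 x = card {(i, j, k). x + (e i + e j + e k) \<in> C}"

definition rep4 :: "bit ^ 'm \<Rightarrow> nat" where
  "rep4 x = card {(i, j, k, l). x + (e i + e j + e k + e l) \<in> C}"

lemma rep4_eq_sum_rep3: "rep4 x = (\<Sum>c\<in>UNIV. rep3 (x + e c))"
proof -
  have "{(c, i, j, k). x + (e c + e i + e j + e k) \<in> C}
    = (SIGMA c:UNIV. {(i, j, k). x + e c + (e i + e j + e k) \<in> C})"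
    by (auto simp: ac_simps)
  then show ?thesis
    unfolding rep4_def rep3_def by simp
qed

definition triples :: "bit ^ 'm \<Rightarrow> 'i set set" where
  "triples x = {t. card t = 3 \<and> x + (\<Sum>i\<in>t. e i) \<in> C}"

text \<open>Two triples with a common element \<open>i\<close> have congruent sums of their remaining pairs, and the
Sidon property forces these pairs to coincide.\<close>

lemma triples_disjoint:
  assumes "t \<in> triples x" "t' \<in> triples x" "i \<in> t" "i \<in> t'"
  shows "t = t'"
proof -
  have dec: "\<exists>j k. t = {i, j, k} \<and> i \<noteq> j \<and> i \<noteq> k \<and> j \<noteq> k \<and> x + (e i + e j + e k) \<in> C"
    if t: "t \<in> triples x" "i \<in> t" for t
  proof -
    have "card (t - {i}) = 2"
      using t by (simp add: triples_def)
    then obtain j k where jk: "t - {i} = {j, k}" "j \<noteq> k"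
      by (meson card_2_iff)
    then have "t = {i, j, k}" "i \<noteq> j" "i \<noteq> k"
      using t(2) by blast+
    then show ?thesis
      using t(1) jk(2) by (intro exI[of _ j] exI[of _ k]) (simp add: triples_def ac_simps)
  qed
  obtain j k where t: "t = {i, j, k}" "j \<noteq> k" "x + (e i + e j + e k) \<in> C"
    using dec[OF assms(1,3)] by blast
  obtain j' k' where t': "t' = {i, j', k'}" "x + (e i + e j' + e k') \<in> C"
    using dec[OF assms(2,4)] by blast
  have "e j + e k + e j' + e k' \<in> C"
    using add_mem[OF t(3) t'(2)] by (simp add: ac_simps)
  with sidon[of j k j' k'] t t' show ?thesis
    by auto
qed

lemma card_Union_triples: "card (\<Union> (triples x)) = 3 * card (triples x)"
proof -
  have "card (\<Union> (triples x)) = (\<Sum>t\<in>triples x. card t)"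
    by (intro card_Union_disjoint)
      (use triples_disjoint in \<open>auto simp: pairwise_def disjnt_def triples_def\<close>)
  also have "\<dots> = 3 * card (triples x)"
    by (simp add: triples_def)
  finally show ?thesis .
qed

text \<open>Each triple sums to \<open>x\<close> modulo the code, and an even number of copies of \<open>x\<close> cancels.\<close>

lemma sum_Union_triples:
  assumes "even (card (triples x))"
  shows "(\<Sum>i\<in>\<Union> (triples x). e i) \<in> C"
proof -
  have par: "(\<Sum>t\<in>A. \<Sum>i\<in>t. e i) + (if even (card A) then 0 else x) \<in> C" if "A \<subseteq> triples x" for A
  proof -
    have "finite A" by simp
    then show ?thesis
      using that
    proof (induction A rule: finite_induct)
      case empty
      then show ?case by (simp add: zero_mem)
    next
      case (insert t A)
      then have t: "x + (\<Sum>i\<in>t. e i) \<in> C"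
        by (simp add: triples_def)
      have "(\<Sum>t\<in>A. \<Sum>i\<in>t. e i) + (if even (card A) then 0 else x) \<in> C"
        using insert by blast
      from add_mem[OF t this] show ?case
        using insert.hyps by (cases "even (card A)") (simp_all add: ac_simps)
    qed
  qed
  have "(\<Sum>i\<in>\<Union> (triples x). e i) = (\<Sum>t\<in>triples x. \<Sum>i\<in>t. e i)"
    using triples_disjoint by (subst sum.Union_disjoint) (auto simp: o_def)
  then show ?thesis
    using par[of "triples x"] assms by simp
qed

text \<open>Since \<open>x\<close> is not congruent to any \<open>e i\<close>, every representation of \<open>x\<close> has three distinct
entries and is an ordering of a triple. Its first entry lies in the union of the triples and
determines the other two up to order.\<close>

lemma rep3_le:
  assumes off: "\<And>i. x + e i \<notin> C"
  shows "rep3 x \<le> 2 * card (\<Union> (triples x))"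
proof -
  have fibre: "card {(j, k). x + (e i + e j + e k) \<in> C} \<le> (if i \<in> \<Union> (triples x) then 2 else 0)" for i
  proof (cases "{(j, k). x + (e i + e j + e k) \<in> C} = {}")
    case True
    then show ?thesis by simp
  next
    case False
    then obtain j k where jk: "x + (e i + e j + e k) \<in> C"
      by blast
    have ne: "i \<noteq> j" "i \<noteq> k" "j \<noteq> k"
      using jk off[of k] off[of j] off[of i] by (auto simp: ac_simps)
    then have "{i, j, k} \<in> triples x"
      using jk by (simp add: triples_def ac_simps)
    then have "i \<in> \<Union> (triples x)"
      by blast
    have "{(j, k). x + (e i + e j + e k) \<in> C} \<subseteq> {(j, k), (k, j)}"
    proof (rule subsetI)
      fix p assume "p \<in> {(j, k). x + (e i + e j + e k) \<in> C}"
      then obtain j' k' where p: "p = (j', k')" and jk': "x + (e i + e j' + e k') \<in> C"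
        by blast
      have "e j + e k + e j' + e k' \<in> C"
        using add_mem[OF jk jk'] by (simp add: ac_simps)
      then show "p \<in> {(j, k), (k, j)}"
        using sidon[of j k j' k'] ne(3) p by blast
    qed
    moreover have "card {(j, k), (k, j)} = 2"
      using ne(3) by simp
    ultimately have "card {(j, k). x + (e i + e j + e k) \<in> C} \<le> 2"
      by (metis (no_types, lifting) card_mono finite)
    then show ?thesis
      using \<open>i \<in> \<Union> (triples x)\<close> by simp
  qed
  have "{(i, j, k). x + (e i + e j + e k) \<in> C} = (SIGMA i:UNIV. {(j, k). x + (e i + e j + e k) \<in> C})"
    by auto
  then have "rep3 x = (\<Sum>i\<in>UNIV. card {(j, k). x + (e i + e j + e k) \<in> C})"
    unfolding rep3_def by simp
  also have "\<dots> \<le> (\<Sum>i\<in>UNIV. if i \<in> \<Union> (triples x) then 2 else 0)"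
    by (intro sum_mono fibre)
  also have "\<dots> = 2 * card (\<Union> (triples x))"
    by (simp add: sum.If_cases del: Union_iff)
  finally show ?thesis .
qed

text \<open>If \<open>x\<close> is congruent to \<open>e b\<close>, only degenerate representations remain: one entry is \<open>b\<close> and
the other two are equal. The three positions of \<open>b\<close> overlap exactly in \<open>(b, b, b)\<close>.\<close>

lemma rep3_le_member:
  assumes b: "x + e b \<in> C"
  shows "rep3 x \<le> 3 * CARD('i) - 2"
proof -
  let ?A = "(\<lambda>j. (b, j, j)) ` (UNIV :: 'i set)" and ?B = "(\<lambda>j. (j, b, j)) ` (- {b})" and ?D = "(\<lambda>j. (j, j, b)) ` (- {b})"
  have "{(i, j, k). x + (e i + e j + e k) \<in> C} \<subseteq> ?A \<union> ?B \<union> ?D"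
  proof (rule subsetI)
    fix p assume "p \<in> {(i, j, k). x + (e i + e j + e k) \<in> C}"
    then obtain i j k where p: "p = (i, j, k)" and ijk: "x + (e i + e j + e k) \<in> C"
      by blast
    have "e b + e i + e j + e k \<in> C"
      using add_mem[OF b ijk] by (simp add: ac_simps)
    then consider "b = i" "j = k" | "b \<noteq> i" "b = j" "i = k" | "b \<noteq> i" "b = k" "i = j"
      using sidon[of b i j k] by blast
    then show "p \<in> ?A \<union> ?B \<union> ?D"
      by cases (simp_all add: p image_iff)
  qed
  then have "rep3 x \<le> card (?A \<union> ?B \<union> ?D)"
    unfolding rep3_def by (intro card_mono) simp_all
  moreover have "card (?A \<union> ?B \<union> ?D) \<le> card (?A \<union> ?B) + card ?D" "card (?A \<union> ?B) \<le> card ?A + card ?B"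
    by (rule card_Un_le)+
  moreover have "card ?A = CARD('i)" "card ?B = CARD('i) - 1" "card ?D = CARD('i) - 1"
    by (simp_all add: card_image inj_on_def Compl_eq_Diff_UNIV)
  moreover have "0 < CARD('i)"
    by simp
  ultimately show ?thesis
    by linarith
qed

lemma rep4_le_mem:
  assumes "x \<in> C"
  shows "rep4 x \<le> CARD('i) * (3 * CARD('i) - 2)"
proof -
  have "rep4 x \<le> (\<Sum>c\<in>(UNIV :: 'i set). 3 * CARD('i) - 2)"
    unfolding rep4_eq_sum_rep3 by (intro sum_mono) (metis rep3_le_member assms add.assoc add_self_bit_vec add_0_right)
  then show ?thesis by simp
qed

lemma rep2_ge_mem:
  assumes "x \<in> C"
  shows "CARD('i) \<le> rep2 x"
proof -
  have "card ((\<lambda>i. (i, i)) ` (UNIV :: 'i set)) \<le> rep2 x"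
    unfolding rep2_def by (intro card_mono) (use assms in auto)
  then show ?thesis
    by (simp add: card_image inj_on_def)
qed

text \<open>The first entry \<open>c\<close> of a representation leaves \<open>x + e c\<close> to be written as a sum of three. For
\<open>c\<close> equal to \<open>a\<close> or \<open>b\<close> this is congruent to a member of the family; for all other \<open>c\<close> it is not,
and the disjoint triples cannot cover everything because the size of the family is 2 modulo 3.\<close>

lemma rep4_le_collision:
  assumes ab: "a \<noteq> b" "x + (e a + e b) \<in> C" and card: "CARD('i) mod 3 = 2"
  shows "rep4 x \<le> 2 * (3 * CARD('i) - 2) + (CARD('i) - 2) * (2 * (CARD('i) - 2))"
proof -
  have third_le: "3 * r \<le> n - 2" if "3 * r \<le> n" "n mod 3 = 2" for r n :: nat
    using that by presburger
  have bound: "rep3 (x + e c) \<le> (if c \<in> {a, b} then 3 * CARD('i) - 2 else 2 * (CARD('i) - 2))" for c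
  proof (cases "c \<in> {a, b}")
    case True
    then obtain d where "x + e c + e d \<in> C"
      using ab by (auto simp: ac_simps)
    then show ?thesis
      using True rep3_le_member by simp
  next
    case False
    have "x + e c + e i \<notin> C" for i
    proof
      assume *: "x + e c + e i \<in> C"
      have "e a + e b + e c + e i \<in> C"
        using add_mem[OF * ab(2)] by (simp add: ac_simps)
      then show False
        using sidon[of a b c i] ab(1) False by auto
    qed
    then have "rep3 (x + e c) \<le> 2 * card (\<Union> (triples (x + e c)))"
      by (rule rep3_le)
    moreover have "card (\<Union> (triples (x + e c))) \<le> CARD('i)"
      by (intro card_mono) auto
    ultimately show ?thesis
      using third_le[of "card (triples (x + e c))" "CARD('i)"] card False unfolding card_Union_triples by auto
  qed
  have "rep4 x \<le> (\<Sum>c\<in>UNIV. if c \<in> {a, b} then 3 * CARD('i) - 2 else 2 * (CARD('i) - 2))"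
    unfolding rep4_eq_sum_rep3 by (intro sum_mono bound)
  also have "\<dots> = 2 * (3 * CARD('i) - 2) + (CARD('i) - 2) * (2 * (CARD('i) - 2))"
  proof -
    have "UNIV \<inter> {c. c \<in> {a, b}} = {a, b}" "UNIV \<inter> - {c. c \<in> {a, b}} = UNIV - {a, b}"
      by auto
    moreover have "card {a, b} = 2" "card (UNIV - {a, b}) = CARD('i) - 2"
      using ab(1) by (simp_all add: card_Diff_subset)
    ultimately show ?thesis
      by (subst sum.If_cases) (simp_all only: finite sum_constant of_nat_id)
  qed
  finally show ?thesis .
qed

text \<open>A representation of \<open>s + e c\<close>, where \<open>s\<close> is the sum of the whole family, cannot use \<open>c\<close>, because \<open>s\<close>
is not a sum of two members. Hence the triples cover at most \<open>CARD('i) - 2\<close> indices. If they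
covered that many, their number would be even, so the covered members would sum to zero modulo
the code and \<open>s\<close> would be congruent to the sum of the two uncovered ones. As the covered number
is a multiple of 3, it drops by at least 3 more.\<close>

lemma rep4_le_no_collision:
  assumes off: "\<And>i j. (\<Sum>k\<in>UNIV. e k) + (e i + e j) \<notin> C" and card: "CARD('i) mod 6 = 2"
  shows "rep4 (\<Sum>k\<in>UNIV. e k) \<le> CARD('i) * (2 * (CARD('i) - 5))"
proof -
  let ?s = "\<Sum>k\<in>UNIV. e k"
  have third_gap: "u \<le> n - 5" if "u = 3 * r" "u < n" "n mod 6 = 2" "u \<noteq> n - 2" for r n u :: nat
    using that by presburger
  have even_third: "even r" if "3 * r = n - 2" "n mod 6 = 2" for r n :: nat
    using that by presburger
  have bound: "rep3 (?s + e c) \<le> 2 * (CARD('i) - 5)" for c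
  proof -
    let ?U = "\<Union> (triples (?s + e c))"
    have "c \<notin> ?U"
    proof
      assume "c \<in> ?U"
      then obtain t where t: "c \<in> t" "card t = 3" "?s + e c + (\<Sum>i\<in>t. e i) \<in> C"
        by (auto simp: triples_def)
      then have "card (t - {c}) = 2"
        by simp
      then obtain i j where ij: "t - {c} = {i, j}" "i \<noteq> j"
        by (meson card_2_iff)
      have "(\<Sum>i\<in>t. e i) = e c + (e i + e j)"
        using t(1) ij by (subst sum.remove[of t c]) auto
      then show False
        using t(3) off[of i j] by (simp add: add.assoc)
    qed
    then have "card (insert c ?U) = Suc (card ?U)" by simp
    moreover have "card (insert c ?U) \<le> CARD('i)"
      by (intro card_mono) auto
    ultimately have less: "card ?U < CARD('i)"
      by simp
    have "card ?U \<noteq> CARD('i) - 2"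
    proof
      assume eq: "card ?U = CARD('i) - 2"
      then have "even (card (triples (?s + e c)))"
        by (intro even_third[OF _ card]) (simp only: card_Union_triples)
      then have U: "(\<Sum>i\<in>?U. e i) \<in> C"
        by (rule sum_Union_triples)
      have "card (- ?U) = 2"
        using eq card less by (simp add: Compl_eq_Diff_UNIV card_Diff_subset)
      then obtain i j where ij: "- ?U = {i, j}" "i \<noteq> j"
        by (meson card_2_iff)
      have "?s = (\<Sum>i\<in>?U. e i) + (\<Sum>i\<in>- ?U. e i)"
        by (metis Compl_eq_Diff_UNIV add.commute finite subset_UNIV sum.subset_diff)
      also have "(\<Sum>i\<in>- ?U. e i) = e i + e j"
        unfolding ij(1) using ij(2) by simp
      finally have "?s + (e i + e j) = (\<Sum>i\<in>?U. e i) + (e i + e j) + (e i + e j)"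
        by (rule arg_cong)
      also have "\<dots> = (\<Sum>i\<in>?U. e i)"
        by (simp only: add.assoc add_self_bit_vec add_0_right)
      finally have "?s + (e i + e j) = (\<Sum>i\<in>?U. e i)" .
      then show False
        using U off[of i j] by metis
    qed
    then have "card ?U \<le> CARD('i) - 5"
      by (rule third_gap[OF card_Union_triples less card])
    moreover have "rep3 (?s + e c) \<le> 2 * card ?U"
      using off[of c] by (intro rep3_le) (simp add: add.assoc)
    ultimately show ?thesis
      by simp
  qed
  have "rep4 ?s \<le> (\<Sum>c\<in>(UNIV :: 'i set). 2 * (CARD('i) - 5))"
    unfolding rep4_eq_sum_rep3 by (intro sum_mono bound)
  then show ?thesis
    by simp
qed

section \<open>Moments of the character sums\<close>

definition char_sum :: "bit ^ 'm \<Rightarrow> int" where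
  "char_sum u = (\<Sum>i\<in>UNIV. character u (e i))"

text \<open>The product of the signs \<open>character u (e i)\<close> is the character of the total sum, so triviality
of the latter means that the number of negative signs is even.\<close>

lemma char_sum_mod_4:
  assumes "character u (\<Sum>i\<in>UNIV. e i) = 1" "CARD('i) mod 4 = 2"
  shows "char_sum u mod 4 = 2"
proof -
  let ?W = "{i. character u (e i) = - 1}"
  have "(\<Prod>i\<in>UNIV. character u (e i)) = (\<Prod>i\<in>UNIV. if i \<in> ?W then - 1 else 1)"
    using character_cases by (intro prod.cong) auto
  also have "\<dots> = (- 1) ^ card ?W"
    by (subst prod.If_cases) simp_all
  finally have "even (card ?W)"
    using assms(1) by (cases "even (card ?W)") (simp_all add: character_sum_right)
  have "char_sum u = (\<Sum>i\<in>UNIV. 1 - 2 * (if i \<in> ?W then 1 else 0))"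
    unfolding char_sum_def using character_cases by (intro sum.cong) auto
  also have "\<dots> = int CARD('i) - 2 * int (card ?W)"
    by (simp add: sum_subtractf sum.If_cases flip: sum_distrib_left)
  finally show ?thesis
    using \<open>even (card ?W)\<close> assms(2) by presburger
qed

text \<open>A subgroup of index two in the dual, or the whole dual if the family sums to a code word.\<close>

definition half_dual :: "(bit ^ 'm) set" where
  "half_dual = {u. u \<in> dual C \<and> character u (\<Sum>i\<in>UNIV. e i) = 1}"

lemma char_sum_power_2: "char_sum u ^ 2 = (\<Sum>(i, j)\<in>UNIV. character u (e i + e j))"
  by (simp add: char_sum_def power2_eq_square sum_product sum.cartesian_product character_add_right)

lemma char_sum_power_4:
  "char_sum u ^ 4 = (\<Sum>(i, j, k, l)\<in>UNIV. character u (e i + e j + e k + e l))"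
proof -
  have product: "sum f UNIV * sum g UNIV = (\<Sum>(a, b)\<in>UNIV. f a * g b)"
    for f :: "'i \<Rightarrow> int" and g :: "'b::finite \<Rightarrow> int"
    by (simp add: sum_product sum.cartesian_product)
  have "char_sum u ^ 4 = char_sum u * (char_sum u * (char_sum u * char_sum u))"
    by (simp add: power4_eq_xxxx mult.assoc)
  then show ?thesis
    unfolding char_sum_def product by (simp add: character_add_right split_def mult.assoc)
qed

lemma sum_char_sum_power_2:
  "2 * (\<Sum>u\<in>half_dual. char_sum u ^ 2)
    = int (card (dual C)) * (int (rep2 0) + int (rep2 (\<Sum>i\<in>UNIV. e i)))"
  using sum_character_half_dual[OF subspace, where w = "\<Sum>i\<in>UNIV. e i" and s = "\<lambda>(i, j). e i + e j"]
  by (simp add: half_dual_def char_sum_power_2 rep2_def split_def)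

lemma sum_char_sum_power_4:
  "2 * (\<Sum>u\<in>half_dual. char_sum u ^ 4)
    = int (card (dual C)) * (int (rep4 0) + int (rep4 (\<Sum>i\<in>UNIV. e i)))"
  using sum_character_half_dual[OF subspace, where w = "\<Sum>i\<in>UNIV. e i" and s = "\<lambda>(i, j, k, l). e i + e j + e k + e l"]
  by (simp add: half_dual_def char_sum_power_4 rep4_def split_def)

lemma card_half_dual:
  "2 * int (card half_dual) = int (card (dual C)) * (1 + (if (\<Sum>i\<in>UNIV. e i) \<in> C then 1 else 0))"
  using sum_character_half_dual[OF subspace, where w = "\<Sum>i\<in>UNIV. e i" and s = "\<lambda>_ :: unit. 0"]
  by (simp add: half_dual_def zero_mem)

text \<open>Multiplied by \<open>card (dual C)\<close>, the left-hand side is twice the sum over \<open>half_dual\<close> of the quartic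
polynomial of \<open>square_mod_four_bound\<close> with \<open>q = 4 * m\<^sup>2\<close>. The right-hand side is what the estimates give when
\<open>\<sigma>\<close> is congruent to a sum of two members of the family; there the large bound for \<open>rep4 \<sigma>\<close> is
partly offset by \<open>rep2 \<sigma> \<ge> 2\<close>. The other two cases stay below it.\<close>

lemma moment_bound:
  assumes card: "int CARD('i) = q - 2" "q mod 12 = 4" "q \<ge> 16"
  defines "\<sigma> \<equiv> \<Sum>i\<in>UNIV. e i"
  shows "int (rep4 0) + int (rep4 \<sigma>) - 2 * (q + 4) * (int (rep2 0) + int (rep2 \<sigma>))
      + (q - 4)\<^sup>2 * (1 + (if \<sigma> \<in> C then 1 else 0)) \<le> 4 * q\<^sup>2 - 40 * q + 48"
proof -
  have nat_card: "CARD('i) mod 6 = 2" "CARD('i) mod 3 = 2" "CARD('i) \<ge> 14"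
  proof -
    define l where "l = nat (q div 12)"
    have "q div 12 \<ge> 1"
      using card(3) by simp
    then have "int l = q div 12" "l \<ge> 1"
      by (simp_all add: l_def)
    moreover have "q = 12 * (q div 12) + 4"
      using card(2) by (metis mult_div_mod_eq)
    ultimately have "int CARD('i) = int (12 * l + 2)"
      using card(1) by simp
    then have l: "CARD('i) = 12 * l + 2"
      by (simp only: of_nat_eq_iff)
    show "CARD('i) mod 6 = 2" "CARD('i) mod 3 = 2"
      unfolding l by presburger+
    show "CARD('i) \<ge> 14"
      unfolding l using \<open>l \<ge> 1\<close> by simp
  qed
  have rep4_mem: "int (rep4 x) \<le> (q - 2) * (3 * q - 8)" if "x \<in> C" for x
  proof -
    have "int (rep4 x) \<le> int (CARD('i) * (3 * CARD('i) - 2))"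
      using rep4_le_mem[OF that] by (simp only: of_nat_le_iff)
    also have "\<dots> = (q - 2) * (3 * q - 8)"
      using nat_card by (simp add: of_nat_diff card(1))
    finally show ?thesis .
  qed
  have rep2_mem: "q - 2 \<le> int (rep2 x)" if "x \<in> C" for x
    using rep2_ge_mem[OF that] card(1) by linarith
  have rep2_mult: "2 * (q + 4) * y \<le> 2 * (q + 4) * int (rep2 x)" if "y \<le> int (rep2 x)" for x y
    using that card(3) by (intro mult_left_mono) auto
  have zero: "int (rep4 0) \<le> (q - 2) * (3 * q - 8)" "2 * (q + 4) * (q - 2) \<le> 2 * (q + 4) * int (rep2 0)"
    using zero_mem rep4_mem rep2_mem rep2_mult by blast+
  have qq: "16 * q \<le> q\<^sup>2"
    using card(3) by (simp add: power2_eq_square)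
  consider (mem) "\<sigma> \<in> C"
    | (collision) a b where "\<sigma> \<notin> C" "\<sigma> + (e a + e b) \<in> C" "a \<noteq> b"
    | (no_collision) "\<sigma> \<notin> C" "\<And>a b. \<sigma> + (e a + e b) \<notin> C"
    by (metis add_self_bit_vec add_0_right)
  then show ?thesis
  proof cases
    case mem
    have "int (rep4 \<sigma>) \<le> (q - 2) * (3 * q - 8)" "2 * (q + 4) * (q - 2) \<le> 2 * (q + 4) * int (rep2 \<sigma>)"
      using mem rep4_mem rep2_mem rep2_mult by blast+
    with zero mem qq card(3) show ?thesis
      by (simp add: algebra_simps power2_eq_square)
  next
    case collision
    have "int (rep4 \<sigma>) \<le> int (2 * (3 * CARD('i) - 2) + (CARD('i) - 2) * (2 * (CARD('i) - 2)))"
      using rep4_le_collision[OF collision(3,2) nat_card(2)] by (simp only: of_nat_le_iff)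
    also have "\<dots> = 2 * (3 * q - 8) + (q - 4) * (2 * (q - 4))"
      using nat_card by (simp add: of_nat_diff card(1))
    finally have rep4: "int (rep4 \<sigma>) \<le> 2 * (3 * q - 8) + (q - 4) * (2 * (q - 4))" .
    have "card {(a, b), (b, a)} \<le> rep2 \<sigma>"
      unfolding rep2_def using collision(2) by (intro card_mono) (auto simp: add.commute)
    then have "2 \<le> int (rep2 \<sigma>)"
      using collision(3) by simp
    then have "2 * (q + 4) * 2 \<le> 2 * (q + 4) * int (rep2 \<sigma>)"
      by (rule rep2_mult)
    with zero collision(1) rep4 show ?thesis
      by (simp add: algebra_simps power2_eq_square)
  next
    case no_collision
    have "int (rep4 \<sigma>) \<le> int (CARD('i) * (2 * (CARD('i) - 5)))"
      using rep4_le_no_collision[OF no_collision(2)[unfolded \<sigma>_def] nat_card(1)]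
      unfolding \<sigma>_def by (simp only: of_nat_le_iff)
    also have "\<dots> = (q - 2) * (2 * (q - 7))"
      using nat_card by (simp add: of_nat_diff card(1))
    finally have rep4: "int (rep4 \<sigma>) \<le> (q - 2) * (2 * (q - 7))" .
    have "2 * (q + 4) * (q - 2) \<le> 2 * (q + 4) * (int (rep2 0) + int (rep2 \<sigma>))"
      using rep2_mem[OF zero_mem] card(3) by (intro mult_left_mono) auto
    with zero(1) rep4 have "int (rep4 0) + int (rep4 \<sigma>) - 2 * (q + 4) * (int (rep2 0) + int (rep2 \<sigma>)) + (q - 4)\<^sup>2
      \<le> (q - 2) * (3 * q - 8) + (q - 2) * (2 * (q - 7)) - 2 * (q + 4) * (q - 2) + (q - 4)\<^sup>2"
      by simp
    also have "\<dots> \<le> 4 * q\<^sup>2 - 40 * q + 48"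
      using card(3) by (simp add: algebra_simps power2_eq_square)
    finally show ?thesis
      using no_collision(1) by simp
  qed
qed

text \<open>The quartic polynomial is nonnegative at every character sum over \<open>half_dual\<close>, so its value
\<open>P (q - 2)\<close> at the trivial character is at most the whole sum. If the dual had \<open>q\<^sup>2 / 2\<close> elements, with
\<open>q = 4 * m\<^sup>2\<close>, then four times that sum would be at most \<open>4 * q ^ 4 - 40 * q ^ 3 + 48 * q\<^sup>2\<close>. But
\<open>4 * P (q - 2) = 4 * q ^ 4 - 40 * q ^ 3 + 100 * q\<^sup>2 - 64 * q\<close> is larger.\<close>

lemma card_dual_ne:
  assumes "int CARD('i) = 4 * m\<^sup>2 - 2" "even m" "\<not> 3 dvd m" "m \<ge> 2"
  shows "2 * int (card (dual C)) \<noteq> (4 * m\<^sup>2)\<^sup>2"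
proof
  define q where "q = 4 * m\<^sup>2"
  define \<sigma> where "\<sigma> = (\<Sum>i\<in>UNIV. e i)"
  define P :: "int \<Rightarrow> int" where "P f = f ^ 4 - 2 * (q + 4) * f\<^sup>2 + (q - 4)\<^sup>2" for f
  define R where "R = int (rep4 0) + int (rep4 \<sigma>) - 2 * (q + 4) * (int (rep2 0) + int (rep2 \<sigma>))
      + (q - 4)\<^sup>2 * (1 + (if \<sigma> \<in> C then 1 else 0))"
  assume dual: "2 * int (card (dual C)) = (4 * m\<^sup>2)\<^sup>2"
  obtain k where k: "m = 2 * k"
    using assms(2) by blast
  have "k mod 3 = 1 \<or> k mod 3 = 2"
    using assms(3) k by presburger
  moreover have "k\<^sup>2 mod 3 = (k mod 3) * (k mod 3) mod 3"
    by (simp add: power2_eq_square mod_mult_eq)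
  ultimately have "k\<^sup>2 mod 3 = 1"
    by auto
  then have "(16 * k\<^sup>2) mod 12 = 4"
    by presburger
  then have q_mod: "q mod 12 = 4"
    by (simp add: q_def k power_mult_distrib)
  have "2\<^sup>2 \<le> m\<^sup>2"
    using assms(4) by (intro power_mono) auto
  then have q_ge: "q \<ge> 16"
    unfolding q_def by simp
  have card: "int CARD('i) = q - 2"
    using assms(1) q_def by simp
  have R_le: "R \<le> 4 * q\<^sup>2 - 40 * q + 48"
    unfolding R_def \<sigma>_def using card q_mod q_ge by (rule moment_bound)
  have "int CARD('i) mod 4 = (16 * k\<^sup>2 - 2) mod 4"
    using card by (simp add: q_def k power_mult_distrib)
  also have "\<dots> = 2"
    by presburger
  finally have "int (CARD('i) mod 4) = int 2"
    by (simp only: zmod_int of_nat_numeral)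
  then have "CARD('i) mod 4 = 2"
    by (simp only: of_nat_eq_iff)
  then have "char_sum u mod 4 = 2" if "u \<in> half_dual" for u
    using that by (intro char_sum_mod_4) (simp_all add: half_dual_def)
  then have P_nonneg: "0 \<le> P (char_sum u)" if "u \<in> half_dual" for u
    unfolding P_def q_def using that assms(2,4) by (intro square_mod_four_bound) auto
  have "0 \<in> half_dual"
    by (simp add: half_dual_def dual_def)
  have "char_sum 0 = q - 2"
    by (simp add: char_sum_def card)
  then have le: "P (q - 2) \<le> (\<Sum>u\<in>half_dual. P (char_sum u))"
    using member_le_sum[OF \<open>0 \<in> half_dual\<close>, of "\<lambda>u. P (char_sum u)"] P_nonneg by simp
  have sum_P: "2 * (\<Sum>u\<in>half_dual. P (char_sum u)) = int (card (dual C)) * R"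
  proof -
    have factor: "d * a - c * (d * b) + g * (d * h) = d * (a - c * b + g * h)" for a b c d g h :: int
      by (simp add: algebra_simps)
    have "(\<Sum>u\<in>half_dual. P (char_sum u))
      = (\<Sum>u\<in>half_dual. char_sum u ^ 4) - 2 * (q + 4) * (\<Sum>u\<in>half_dual. char_sum u ^ 2)
        + int (card half_dual) * (q - 4)\<^sup>2"
      by (simp only: P_def sum.distrib sum_subtractf sum_constant flip: sum_distrib_left)
    then have "2 * (\<Sum>u\<in>half_dual. P (char_sum u))
      = 2 * (\<Sum>u\<in>half_dual. char_sum u ^ 4) - 2 * (q + 4) * (2 * (\<Sum>u\<in>half_dual. char_sum u ^ 2))
        + (q - 4)\<^sup>2 * (2 * int (card half_dual))"
      by (simp only: distrib_left right_diff_distrib ac_simps)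
    then show ?thesis
      unfolding sum_char_sum_power_2 sum_char_sum_power_4 card_half_dual R_def \<sigma>_def
      by (simp only: factor)
  qed
  (* The inequalities are combined with the nonlinear terms replaced by variables. *)
  have combine: False
    if "x = 2 * y" "x \<le> z" "z = 4 * p - 4 * w" "0 < w" "p \<le> s" "2 * s = y" for x y z p w s :: int
    using that by linarith
  show False
  proof (rule combine)
    show "q\<^sup>2 * R = 2 * (int (card (dual C)) * R)"
      unfolding q_def dual[symmetric] by (simp only: mult.assoc)
    show "q\<^sup>2 * R \<le> q\<^sup>2 * (4 * q\<^sup>2 - 40 * q + 48)"
      by (rule mult_left_mono[OF R_le]) simp
    show "q\<^sup>2 * (4 * q\<^sup>2 - 40 * q + 48) = 4 * P (q - 2) - 4 * (q * (13 * q - 16))"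
      unfolding P_def by algebra
    show "0 < q * (13 * q - 16)"
      using q_ge by (intro mult_pos_pos) simp_all
  qed (fact le, fact sum_P)
qed

end

section \<open>Codes of minimum distance five\<close>

text \<open>The zero vector is adjoined to the unit vectors: a relation that involves it comes from a
word of weight less than 4, which is excluded as well. This turns length \<open>2 ^ t - 3\<close> into a family of size \<open>2 ^ t - 2\<close>.\<close>

definition unit_or_zero :: "'m option \<Rightarrow> bit ^ 'm::finite" where
  "unit_or_zero x = (case x of None \<Rightarrow> 0 | Some i \<Rightarrow> axis i 1)"

lemma unit_or_zero_nth: "unit_or_zero x $ i = of_bool (x = Some i)"
  by (cases x) (auto simp: unit_or_zero_def axis_def)

text \<open>Every index occurs an even number of times among the four arguments, and then so does
\<open>None\<close>, as there are four of them.\<close>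

lemma sum_four_unit_or_zero_eq_0:
  assumes "unit_or_zero x + unit_or_zero y + unit_or_zero z + unit_or_zero w = 0"
  shows "x = y \<and> z = w \<or> x = z \<and> y = w \<or> x = w \<and> y = z"
proof -
  have parity: "((x = Some i) \<noteq> (y = Some i)) = ((z = Some i) \<noteq> (w = Some i))" for i
  proof -
    have "(unit_or_zero x + unit_or_zero y + unit_or_zero z + unit_or_zero w) $ i = 0"
      by (simp only: assms zero_index)
    then show ?thesis
      by (cases "x = Some i"; cases "y = Some i"; cases "z = Some i"; cases "w = Some i")
        (simp_all add: unit_or_zero_nth)
  qed
  have option_eqI: "a = b" if "\<And>i. (a = Some i) = (b = Some i)" for a b :: "'a option"
    using that[of "the a"] that[of "the b"] by (cases a; cases b) auto
  consider "x = y" | "x = z" | "x = w" | "x \<noteq> y" "x \<noteq> z" "x \<noteq> w"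
    by blast
  then show ?thesis
  proof cases
    case 1
    then have "z = w"
      using parity by (intro option_eqI) blast
    with 1 show ?thesis by blast
  next
    case 2
    then have "y = w"
      using parity by (intro option_eqI) blast
    with 2 show ?thesis by blast
  next
    case 3
    then have "y = z"
      using parity by (intro option_eqI) blast
    with 3 show ?thesis by blast
  next
    case 4
    show ?thesis
    proof (cases x)
      case None
      with 4 obtain j k l where "y = Some j" "z = Some k" "w = Some l"
        by (metis option.exhaust)
      then show ?thesis
        using None parity[of j] parity[of k] parity[of l] by auto
    next
      case (Some i)
      then show ?thesis
        using 4 parity[of i] by auto
    qed
  qed
qed

lemma sidon_family_unit_or_zero:
  assumes "vec.subspace C" "\<And>c. c \<in> C \<Longrightarrow> c \<noteq> 0 \<Longrightarrow> 5 \<le> hamming_weight c"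
  shows "sidon_family C unit_or_zero"
proof
  show "vec.subspace C"
    by (fact assms(1))
  fix x y z w :: "'a option"
  let ?c = "unit_or_zero x + unit_or_zero y + unit_or_zero z + unit_or_zero w :: bit ^ 'a"
  assume mem: "?c \<in> C"
  have "{i. ?c $ i \<noteq> 0} \<subseteq> the ` {x, y, z, w}"
  proof (rule subsetI, rule ccontr)
    fix i assume i: "i \<in> {i. ?c $ i \<noteq> 0}" "i \<notin> the ` {x, y, z, w}"
    then have "x \<noteq> Some i" "y \<noteq> Some i" "z \<noteq> Some i" "w \<noteq> Some i"
      by force+
    then have "?c $ i = 0"
      by (simp add: unit_or_zero_nth)
    with i(1) show False
      by simp
  qed
  then have "hamming_weight ?c \<le> card (the ` {x, y, z, w})"
    unfolding hamming_weight_def by (intro card_mono) simp_all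
  also have "\<dots> \<le> card {x, y, z, w}"
    by (intro card_image_le) simp
  also have "\<dots> \<le> 4"
    by (simp add: card_insert_if)
  finally have "?c = 0"
    using assms(2)[OF mem] by auto
  then show "x = y \<and> z = w \<or> x = z \<and> y = w \<or> x = w \<and> y = z"
    by (rule sum_four_unit_or_zero_eq_0)
qed

lemma no_code_of_even_exponent:
  assumes "even t" "4 \<le> t"
  shows "\<not> is_code (2 ^ t - 3) (2 ^ t - 2 * t - 2) 5 (C :: (bit ^ 'm::finite) set)"
proof
  assume code: "is_code (2 ^ t - 3) (2 ^ t - 2 * t - 2) 5 C"
  then have sub: "vec.subspace C" and len: "CARD('m) = 2 ^ t - 3" and dim: "vec.dim C = 2 ^ t - 2 * t - 2"
    and dist: "min_distance C = 5"
    by (simp_all add: is_code_def)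
  have "5 \<le> hamming_weight c" if "c \<in> C" "c \<noteq> 0" for c
  proof -
    have "min_distance C \<le> hamming_weight c"
      unfolding min_distance_def using that by (intro Min_le) simp_all
    then show ?thesis
      unfolding dist .
  qed
  then interpret sidon_family C unit_or_zero
    using sub by (intro sidon_family_unit_or_zero)
  obtain r where r: "t = 2 * r"
    using assms(1) by (rule evenE)
  define s where "s = r - 1"
  have s: "t = 2 * s + 2" "s \<ge> 1"
    using r assms(2) by (simp_all add: s_def)
  define m :: int where "m = 2 ^ s"
  have q: "4 * m\<^sup>2 = 2 ^ t"
  proof -
    have "(2 :: int) ^ t = 2 ^ (s * 2) * 4"
      by (simp add: s(1) power_add ac_simps)
    then show ?thesis
      by (simp add: m_def power_mult)
  qed
  have large: "2 * t + 2 \<le> 2 ^ t"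
    using assms(2) by (induction t rule: nat_induct_at_least) auto
  have "2 ^ vec.dim C * card (dual C) = 2 ^ CARD('m)"
    using card_mult_card_dual[OF sub] card_subspace_bit[OF sub] by simp
  moreover have "CARD('m) = vec.dim C + (2 * t - 1)"
    using large assms(2) unfolding len dim by linarith
  ultimately have "card (dual C) = 2 ^ (2 * t - 1)"
    by (simp add: power_add)
  then have "2 * card (dual C) = 2 ^ Suc (2 * t - 1)"
    by (simp only: power_Suc)
  also have "Suc (2 * t - 1) = t * 2"
    using assms(2) by simp
  finally have "int (2 * card (dual C)) = int (2 ^ (t * 2))"
    by (simp only: of_nat_eq_iff)
  then have dual: "2 * int (card (dual C)) = (4 * m\<^sup>2)\<^sup>2"
    unfolding q by (simp add: power_mult)
  have "int CARD('m option) = int (2 ^ t) - 2"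
    using large assms(2) by (simp add: card_UNIV_option len of_nat_diff)
  then have card: "int CARD('m option) = 4 * m\<^sup>2 - 2"
    unfolding q by simp
  have even: "even m"
    using s(2) by (simp add: m_def)
  have two_le: "2 \<le> m"
    unfolding m_def using power_increasing[OF s(2), of "2 :: int"] by simp
  have not_dvd: "\<not> 3 dvd (2 :: int) ^ j" for j
  proof (induction j)
    case (Suc j)
    have "3 dvd x" if "3 dvd 2 * x" for x :: int
      using that by presburger
    from this[of "2 ^ j"] Suc show ?case
      by auto
  qed simp
  show False
    using card_dual_ne[OF card even not_dvd[of s, folded m_def] two_le] dual by (rule notE)
qed

theorem corollary4p2:
  shows "(\<forall>n::nat. 7 \<le> n \<and> n mod 4 = 3 \<longrightarrow>
            \<not> (\<exists>C :: (bit ^ 'm::finite) set.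
                  is_code (2 ^ ((n + 1) div 2) - 3) (2 ^ ((n + 1) div 2) - n - 3) 5 C)) \<and>
         (\<forall>t::nat. 4 \<le> t \<and> even t \<longrightarrow>
            \<not> (\<exists>C :: (bit ^ 'm) set.
                  is_code (2 ^ t - 3) (2 ^ t - 2 * t - 2) 5 C))"
proof (intro conjI allI impI notI; elim conjE exE)
  fix n :: nat and C :: "(bit ^ 'm) set"
  assume n: "7 \<le> n" "n mod 4 = 3"
    and code: "is_code (2 ^ ((n + 1) div 2) - 3) (2 ^ ((n + 1) div 2) - n - 3) 5 C"
  define t where "t = (n + 1) div 2"
  obtain k where k: "n = 4 * k + 3"
    using n(2) by (metis mult_div_mod_eq)
  then have t: "t = 2 * k + 2"
    by (simp add: t_def)
  have "4 \<le> t" "even t" "n = 2 * t - 1"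
    using n(1) by (simp_all add: k t)
  have "2 ^ t - n - 3 = (2 ^ t - 2 * t - 2 :: nat)"
    using \<open>n = 2 * t - 1\<close> \<open>4 \<le> t\<close> by simp
  then show False
    using code no_code_of_even_exponent[OF \<open>even t\<close> \<open>4 \<le> t\<close>, of C] by (simp only: t_def[symmetric])
next
  fix t :: nat and C :: "(bit ^ 'm) set"
  assume "4 \<le> t" "even t" "is_code (2 ^ t - 3) (2 ^ t - 2 * t - 2) 5 C"
  then show False
    using no_code_of_even_exponent by blast
qed

end
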